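(* Every finite simple graph $G=(V,E)$ with minimum degree $\delta\geq 10^6$ can be decomposed into two $\{1,2\}$-weight colourable subgraphs; that is, $E$ can be partitioned into $E_1$ and $E_2$ such that for each $i\in\{1,2\}$ the graph $G_i=(V,E_i)$ is $\{1,2\}$-weight colourable.
   Context: A graph $F=(V,E)$ is $\{1,2\}$-weight colourable if there is a function $c:E\to\{1,2\}$ such that, writing $d_c(v):=\sum_{u\in N_F(v)}c(uv)$ for the weighted degree of $v$ in $F$, we have $d_c(u)\neq d_c(v)$ for every edge $uv\in E$. *)

theory Defs
  imports Main
begin

definition simple_graph :: "'a set \<Rightarrow> 'a set set \<Rightarrow> bool" where
  "simple_graph V E \<longleftrightarrow> finite V \<and> (\<forall>e\<in>E. e \<subseteq> V \<and> card e = 2)"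

definition degree :: "'a set set \<Rightarrow> 'a \<Rightarrow> nat" where
  "degree E v = card {e\<in>E. v \<in> e}"

definition weighted_degree :: "'a set set \<Rightarrow> ('a set \<Rightarrow> nat) \<Rightarrow> 'a \<Rightarrow> nat" where
  "weighted_degree E c v = (\<Sum>e\<in>{e\<in>E. v \<in> e}. c e)"

definition weight_colourable_12 :: "'a set \<Rightarrow> 'a set set \<Rightarrow> bool" where
  "weight_colourable_12 V E \<longleftrightarrow>
     (\<exists>c :: 'a set \<Rightarrow> nat. (\<forall>e\<in>E. c e \<in> {1, 2}) \<and>
        (\<forall>u v. {u, v} \<in> E \<longrightarrow> weighted_degree E c u \<noteq> weighted_degree E c v))"

end

theory Submission
  imports Defs
begin

text \<open>
  Weighting the edges of a subgraph H of G by 2 and the others by 1 gives v the weighted degree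
  \<open>deg\<^sub>G v + deg\<^sub>H v\<close>. By a theorem of Addario-Berry, Dalal and Reed, H can be chosen so that
  \<open>deg\<^sub>H v\<close> lies in one of two prescribed pairs of consecutive integers around \<open>deg\<^sub>G v / 2\<close>; hence
  \<open>\<lfloor>(deg\<^sub>G v + deg\<^sub>H v) / 2\<rfloor>\<close> can be given any residue \<open>r v\<close> modulo \<open>k v\<close>, as long as \<open>8 k v \<le> deg\<^sub>G v\<close>.

  Let \<open>k v\<close> be the power of two between \<open>deg v / 64\<close> and \<open>deg v / 32\<close>, and give every vertex two
  labels \<open>r v\<close>, \<open>c v\<close> modulo \<open>k v\<close>. There are so many pairs of labels that an assignment minimising
  a weighted count of the conflicts has no edge on which both labels conflict, and only boundedly
  many conflicting edges at each vertex. Edges with an r-conflict go to the second part and edges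
  with a c-conflict to the first one, the remaining edges are halved, and the residues of the
  weighted degrees are prescribed by r in the first part and by c in the second.
\<close>

subsection \<open>Neighbourhoods and degrees\<close>

definition nbrs :: "'a set set \<Rightarrow> 'a \<Rightarrow> 'a set" where
  "nbrs E v = {u. {v, u} \<in> E}"

lemma nbrs_sym: "u \<in> nbrs E v \<longleftrightarrow> v \<in> nbrs E u"
  by (simp add: nbrs_def insert_commute)

lemma simple_graph_subset: "simple_graph V F \<Longrightarrow> H \<subseteq> F \<Longrightarrow> simple_graph V H"
  unfolding simple_graph_def by blast

lemma simple_graph_finite: "simple_graph V F \<Longrightarrow> finite F"
  unfolding simple_graph_def by (meson PowI finite_Pow_iff finite_subset subsetI)

lemma nbrs_subset: "simple_graph V F \<Longrightarrow> nbrs F v \<subseteq> V"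
  unfolding simple_graph_def nbrs_def by blast

lemma finite_nbrs: "simple_graph V F \<Longrightarrow> finite (nbrs F v)"
  using nbrs_subset finite_subset simple_graph_def by metis

lemma not_nbrs_self: "simple_graph V F \<Longrightarrow> v \<notin> nbrs F v"
  unfolding simple_graph_def nbrs_def by fastforce

lemma nbrs_mem_V: "simple_graph V F \<Longrightarrow> u \<in> nbrs F v \<Longrightarrow> u \<in> V \<and> v \<in> V"
  unfolding simple_graph_def nbrs_def by blast

lemma degree_eq_card_nbrs:
  assumes "simple_graph V F"
  shows "degree F v = card (nbrs F v)"
proof -
  have "bij_betw (\<lambda>u. {v, u}) (nbrs F v) {e\<in>F. v \<in> e}"
  proof (rule bij_betwI')
    fix x y assume "x \<in> nbrs F v" "y \<in> nbrs F v"
    then show "({v, x} = {v, y}) = (x = y)" by (auto simp: doubleton_eq_iff)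
  next
    fix x assume "x \<in> nbrs F v"
    then show "{v, x} \<in> {e \<in> F. v \<in> e}" by (simp add: nbrs_def)
  next
    fix e assume e: "e \<in> {e \<in> F. v \<in> e}"
    then have "card e = 2" using assms by (auto simp: simple_graph_def)
    then obtain a b where "e = {a, b}" "a \<noteq> b" by (meson card_2_iff)
    then show "\<exists>x\<in>nbrs F v. e = {v, x}"
      using e by (auto simp: nbrs_def insert_commute)
  qed
  then show ?thesis unfolding degree_def by (metis bij_betw_same_card)
qed

lemma sum_card_nbrs_swap:
  assumes "finite S" "finite T"
  shows "(\<Sum>v\<in>T. card (nbrs H v \<inter> S)) = (\<Sum>u\<in>S. card (nbrs H u \<inter> T))"
proof -
  have c: "card (nbrs H v \<inter> A) = (\<Sum>u\<in>A. of_bool (u \<in> nbrs H v))" if "finite A" for v A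
    using that by (simp add: sum.If_cases of_bool_def Int_commute)
  have "(\<Sum>v\<in>T. card (nbrs H v \<inter> S)) = (\<Sum>v\<in>T. \<Sum>u\<in>S. of_bool (u \<in> nbrs H v))"
    using c assms by simp
  also have "\<dots> = (\<Sum>u\<in>S. \<Sum>v\<in>T. of_bool (v \<in> nbrs H u))"
    by (subst sum.swap) (simp add: nbrs_sym[of _ H])
  also have "\<dots> = (\<Sum>u\<in>S. card (nbrs H u \<inter> T))"
    using c assms by simp
  finally show ?thesis .
qed

text \<open>Every later modification of a subgraph deletes or adds a star; a single edge is the case
  \<open>X = {x}\<close>.\<close>

definition star :: "'a \<Rightarrow> 'a set \<Rightarrow> 'a set set" where
  "star u X = (\<lambda>x. {u, x}) ` X"

lemma mem_star: "{a, b} \<in> star u X \<longleftrightarrow> a = u \<and> b \<in> X \<or> b = u \<and> a \<in> X"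
  by (auto simp: star_def doubleton_eq_iff)

lemma degree_remove_star:
  assumes g: "simple_graph V H" and X: "X \<subseteq> nbrs H u"
  shows "degree (H - star u X) u = degree H u - card X"
    and "x \<in> X \<Longrightarrow> degree (H - star u X) x = degree H x - 1"
    and "y \<noteq> u \<Longrightarrow> y \<notin> X \<Longrightarrow> degree (H - star u X) y = degree H y"
proof -
  have g': "simple_graph V (H - star u X)" by (rule simple_graph_subset[OF g]) auto
  note d = degree_eq_card_nbrs[OF g] degree_eq_card_nbrs[OF g']
  have fin: "finite (nbrs H z)" for z by (rule finite_nbrs[OF g])
  have u: "u \<notin> X" using X not_nbrs_self[OF g] by auto
  have "nbrs (H - star u X) u = nbrs H u - X" using u by (auto simp: nbrs_def mem_star)
  then show "degree (H - star u X) u = degree H u - card X"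
    unfolding d using X fin by (simp add: card_Diff_subset finite_subset)
  show "degree (H - star u X) x = degree H x - 1" if x: "x \<in> X"
  proof -
    have "nbrs (H - star u X) x = nbrs H x - {u}"
      using u x by (auto simp: nbrs_def mem_star)
    moreover have "u \<in> nbrs H x" using X x nbrs_sym by fast
    ultimately show ?thesis unfolding d using fin by simp
  qed
  show "degree (H - star u X) y = degree H y" if y: "y \<noteq> u" "y \<notin> X"
  proof -
    have "nbrs (H - star u X) y = nbrs H y"
      using y by (auto simp: nbrs_def mem_star)
    then show ?thesis unfolding d by simp
  qed
qed

text \<open>The deletion lemma read backwards: no edge of the star lies in \<open>H\<close>, so
  deleting it from \<open>H \<union> star u X\<close> restores \<open>H\<close>.\<close>

lemma degree_add_star:
  assumes g: "simple_graph V F" and H: "H \<subseteq> F" and X: "X \<subseteq> nbrs (F - H) u"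
  shows "degree (H \<union> star u X) u = degree H u + card X"
    and "x \<in> X \<Longrightarrow> degree (H \<union> star u X) x = degree H x + 1"
    and "y \<noteq> u \<Longrightarrow> y \<notin> X \<Longrightarrow> degree (H \<union> star u X) y = degree H y"
proof -
  let ?H = "H \<union> star u X"
  have "star u X \<subseteq> F" using X by (auto simp: star_def nbrs_def)
  then have g': "simple_graph V ?H" using H by (intro simple_graph_subset[OF g]) auto
  have X': "X \<subseteq> nbrs ?H u" by (auto simp: nbrs_def mem_star)
  have "star u X \<inter> H = {}" using X by (auto simp: star_def nbrs_def)
  then have eq: "?H - star u X = H" by auto
  note r = degree_remove_star[OF g' X', unfolded eq]
  have "card X \<le> degree ?H u"
    unfolding degree_eq_card_nbrs[OF g'] by (intro card_mono finite_nbrs[OF g'] X')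
  then show "degree ?H u = degree H u + card X" using r(1) by simp
  show "degree ?H x = degree H x + 1" if x: "x \<in> X"
  proof -
    have "u \<in> nbrs ?H x" using X' x nbrs_sym by fast
    then have "degree ?H x > 0"
      unfolding degree_eq_card_nbrs[OF g'] using finite_nbrs[OF g'] by (auto simp: card_gt_0_iff)
    then show ?thesis using r(2)[OF x] by simp
  qed
  show "degree ?H y = degree H y" if "y \<noteq> u" "y \<notin> X" using r(3)[OF that] by simp
qed

subsection \<open>Subgraphs with degrees in prescribed windows\<close>

text \<open>
  Among all pairs of a subgraph H and a choice \<open>\<tau> v \<in> {lo v, hi v}\<close> with \<open>\<tau> v \<le> deg\<^sub>H v\<close>, minimise the
  total excess of \<open>deg\<^sub>H v\<close> over \<open>\<tau> v + 1\<close>. If a vertex s has positive excess, follow the walks from s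
  alternating between edges in H and outside H. Unless the excess can be pushed away along such
  a walk, the vertices at odd distance have degree exactly \<open>\<tau>\<close> and those at even distance at least
  \<open>\<tau> + 1\<close>. Counting the edges between these two sets yields a vertex at which the choice of \<open>\<tau>\<close> can
  be switched, which unblocks a walk.
\<close>

locale degree_windows =
  fixes V :: "'a set" and F :: "'a set set" and lo hi :: "'a \<Rightarrow> nat"
  assumes graph: "simple_graph V F"
    and lo_hi: "v \<in> V \<Longrightarrow> lo v < hi v"
    and lo_half: "v \<in> V \<Longrightarrow> 2 * lo v \<le> degree F v"
    and hi_half: "v \<in> V \<Longrightarrow> degree F v \<le> 2 * hi v + 1"
    and gap_lo: "v \<in> V \<Longrightarrow> hi v - lo v \<le> lo v"
    and gap_hi: "v \<in> V \<Longrightarrow> 2 * hi v \<le> degree F v + lo v"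
begin

definition valid :: "'a set set \<Rightarrow> ('a \<Rightarrow> nat) \<Rightarrow> bool" where
  "valid H \<tau> \<longleftrightarrow> H \<subseteq> F \<and> (\<forall>v\<in>V. (\<tau> v = lo v \<or> \<tau> v = hi v) \<and> \<tau> v \<le> degree H v)"

text \<open>Truncated subtraction makes degrees \<open>\<tau> v\<close> and
  \<open>\<tau> v + 1\<close> both free, so a valid pair of surplus 0 is exactly what is
  wanted.\<close>

definition surplus :: "'a set set \<Rightarrow> ('a \<Rightarrow> nat) \<Rightarrow> nat" where
  "surplus H \<tau> = (\<Sum>v\<in>V. degree H v - (\<tau> v + 1))"

definition optimal :: "'a set set \<Rightarrow> ('a \<Rightarrow> nat) \<Rightarrow> bool" where
  "optimal H \<tau> \<longleftrightarrow> valid H \<tau> \<and> (\<forall>H' \<tau>'. valid H' \<tau>' \<longrightarrow> surplus H \<tau> \<le> surplus H' \<tau>')"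

text \<open>Ends of alternating walks of length n whose first edge lies in \<open>H\<close>.
  Vertices may repeat, so layers can overlap.\<close>

fun layer :: "'a set set \<Rightarrow> 'a \<Rightarrow> nat \<Rightarrow> 'a set" where
  "layer H s 0 = {s}"
| "layer H s (Suc n) = {y. \<exists>x\<in>layer H s n. {x, y} \<in> F \<and> ({x, y} \<in> H \<longleftrightarrow> even n)}"

lemma finite_V: "finite V"
  using graph by (simp add: simple_graph_def)

lemma edge_V: "{x, y} \<in> F \<Longrightarrow> x \<in> V \<and> y \<in> V \<and> x \<noteq> y"
  using graph nbrs_mem_V[OF graph] not_nbrs_self[OF graph] by (force simp: nbrs_def)

lemma layer_subset: "s \<in> V \<Longrightarrow> layer H s n \<subseteq> V"
  using edge_V by (cases n) auto

text \<open>After a modification of \<open>H\<close>, walks survive once no step that they can take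
  has been toggled; only steps before stage m matter.\<close>

lemma layer_persists:
  assumes "\<And>i y z. \<lbrakk>i < m; y \<in> layer H s i; {y, z} \<in> F; {y, z} \<in> H \<longleftrightarrow> even i\<rbrakk>
             \<Longrightarrow> {y, z} \<in> H' \<longleftrightarrow> even i"
    and "n \<le> m"
  shows "layer H s n \<subseteq> layer H' s n"
  using assms(2)
proof (induction n)
  case (Suc n)
  show ?case
  proof
    fix z assume "z \<in> layer H s (Suc n)"
    then obtain y where y: "y \<in> layer H s n" "{y, z} \<in> F" "{y, z} \<in> H \<longleftrightarrow> even n" by auto
    have "{y, z} \<in> H' \<longleftrightarrow> even n" using assms(1)[OF _ y] Suc.prems by simp
    then show "z \<in> layer H' s (Suc n)" using y Suc by auto
  qed
qed simp

text \<open>If no vertex gains excess, minimality leaves none that loses excess. The new pair is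
  again optimal, so modifications can be chained, and the equality pins down degrees.\<close>

lemma optimal_transfer:
  assumes opt: "optimal H \<tau>" and val: "valid H' \<tau>'"
    and le: "\<And>v. v \<in> V \<Longrightarrow> degree H' v - (\<tau>' v + 1) \<le> degree H v - (\<tau> v + 1)"
  shows "optimal H' \<tau>'"
    and "v \<in> V \<Longrightarrow> degree H' v - (\<tau>' v + 1) = degree H v - (\<tau> v + 1)"
proof -
  have "surplus H' \<tau>' \<le> surplus H \<tau>" unfolding surplus_def by (intro sum_mono le)
  then have eq: "surplus H' \<tau>' = surplus H \<tau>" using opt val by (simp add: optimal_def le_antisym)
  then show "optimal H' \<tau>'" using opt val by (simp add: optimal_def)
  assume v: "v \<in> V"
  show "degree H' v - (\<tau>' v + 1) = degree H v - (\<tau> v + 1)"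
  proof (rule ccontr)
    assume "\<not> ?thesis"
    then have "degree H' v - (\<tau>' v + 1) < degree H v - (\<tau> v + 1)" using le[OF v] by simp
    then have "surplus H' \<tau>' < surplus H \<tau>" unfolding surplus_def
      using v le by (intro sum_strict_mono_ex1 finite_V) auto
    then show False using eq by simp
  qed
qed

text \<open>Induction on the walk length, for all \<open>H\<close> at once. If the claim fails at
  the end x of a walk with last edge tx, toggling tx keeps the pair optimal but makes the claim fail
  at t. The shorter walk to t survives, contradicting the induction hypothesis.\<close>

lemma no_augmenting_walk:
  assumes "optimal H \<tau>" "s \<in> V" "degree H s \<ge> \<tau> s + 2" "x \<in> layer H s n"
  shows "if even n then degree H x \<ge> \<tau> x + 1 else degree H x = \<tau> x"
  using assms
proof (induction n arbitrary: H x rule: less_induct)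
  case (less n)
  note opt = less.prems(1) and s = less.prems(2,3)
  have val: "valid H \<tau>" using opt by (simp add: optimal_def)
  then have HF: "H \<subseteq> F" and tau: "\<And>v. v \<in> V \<Longrightarrow> \<tau> v \<le> degree H v" by (auto simp: valid_def)
  have gH: "simple_graph V H" by (rule simple_graph_subset[OF graph HF])
  have early: "if even i then degree H y \<ge> \<tau> y + 1 else degree H y = \<tau> y"
    if "i < n" "y \<in> layer H s i" for i y
    using less.IH[OF that(1) opt s that(2)] .
  show ?case
  proof (cases n)
    case 0
    then show ?thesis using less.prems by simp
  next
    case (Suc m)
    then obtain t where t: "t \<in> layer H s m" "{t, x} \<in> F" "{t, x} \<in> H \<longleftrightarrow> even m"
      using less.prems by auto
    have V: "t \<in> V" "x \<in> V" "t \<noteq> x" using edge_V[OF t(2)] by auto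
    have tm: "if even m then degree H t \<ge> \<tau> t + 1 else degree H t = \<tau> t"
      using early[OF _ t(1)] Suc by simp
    show ?thesis
    proof (rule ccontr)
      assume neg: "\<not> ?thesis"
      show False
      proof (cases "even m")
        case True
        have dx: "degree H x \<ge> \<tau> x + 1" using neg True Suc tau[OF V(2)] by (auto split: if_splits)
        have dt: "degree H t \<ge> \<tau> t + 1" using tm True by simp
        let ?H = "H - star t {x}"
        have X: "{x} \<subseteq> nbrs H t" using t True by (simp add: nbrs_def)
        note deg = degree_remove_star[OF gH X]
        have deg': "degree ?H v = (if v = t \<or> v = x then degree H v - 1 else degree H v)" for v
          using deg by auto
        have val': "valid ?H \<tau>" using val dx dt by (auto simp: valid_def deg')
        note tr = optimal_transfer[OF opt val']
        have le: "degree ?H v - (\<tau> v + 1) \<le> degree H v - (\<tau> v + 1)" for v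
          unfolding deg' by auto
        have "degree H t = \<tau> t + 1" "degree H x = \<tau> x + 1"
          using tr(2)[OF le V(1)] tr(2)[OF le V(2)] dt dx by (auto simp: deg')
        then have eq: "degree ?H t = \<tau> t" "s \<noteq> t" "s \<noteq> x" using s deg' by auto
        have "layer H s m \<subseteq> layer ?H s m"
        proof (rule layer_persists[where m = m])
          fix i y z assume i: "i < m" "y \<in> layer H s i" "{y, z} \<in> F" "{y, z} \<in> H \<longleftrightarrow> even i"
          \<comment> \<open>Deleting tx can only break steps inside \<open>H\<close>. Such a step
            ends in an odd layer, at a vertex of degree \<open>\<tau>\<close>, whereas t and x both
            have more.\<close>
          have z: "z \<in> layer H s (Suc i)" using i by auto
          have "\<not> (even i \<and> {y, z} \<in> star t {x})"
          proof
            assume a: "even i \<and> {y, z} \<in> star t {x}"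
            have "degree H z = \<tau> z" using early[OF _ z] i Suc a by simp
            then show False using a dx dt by (auto simp: mem_star)
          qed
          then show "{y, z} \<in> ?H \<longleftrightarrow> even i" using i by auto
        qed simp
        then have "t \<in> layer ?H s m" using t by auto
        then show False
          using less.IH[OF _ tr(1)[OF le], of m t] s eq deg' True Suc by simp
      next
        case False
        have dx: "degree H x = \<tau> x" using neg False Suc tau[OF V(2)] by (auto split: if_splits)
        have dt: "degree H t = \<tau> t" using tm False by simp
        let ?H = "H \<union> star t {x}"
        have X: "{x} \<subseteq> nbrs (F - H) t" using t False by (simp add: nbrs_def)
        note deg = degree_add_star[OF graph HF X]
        have deg': "degree ?H v = (if v = t \<or> v = x then degree H v + 1 else degree H v)" for v
          using deg by auto
        have val': "valid ?H \<tau>" using val t tau unfolding valid_def deg' by (auto simp: star_def intro: le_SucI)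
        note tr = optimal_transfer[OF opt val']
        have le: "degree ?H v - (\<tau> v + 1) \<le> degree H v - (\<tau> v + 1)" for v
          using dx dt by (simp add: deg')
        have eq: "s \<noteq> t" "s \<noteq> x" using s dx dt by auto
        have "layer H s m \<subseteq> layer ?H s m"
        proof (rule layer_persists[where m = m])
          fix i y z assume i: "i < m" "y \<in> layer H s i" "{y, z} \<in> F" "{y, z} \<in> H \<longleftrightarrow> even i"
          have z: "z \<in> layer H s (Suc i)" using i by auto
          have "\<not> (odd i \<and> {y, z} \<in> star t {x})"
          proof
            assume a: "odd i \<and> {y, z} \<in> star t {x}"
            have "degree H z \<ge> \<tau> z + 1" using early[OF _ z] i Suc a by simp
            then show False using a dx dt by (auto simp: mem_star)
          qed
          then show "{y, z} \<in> ?H \<longleftrightarrow> even i" using i by auto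
        qed simp
        then have "t \<in> layer ?H s m" using t by auto
        then show False
          using less.IH[OF _ tr(1)[OF le], of m t] s eq deg' dt False Suc by simp
      qed
    qed
  qed
qed

lemma no_surplus:
  assumes opt: "optimal H \<tau>" and s: "s \<in> V"
  shows "degree H s \<le> \<tau> s + 1"
proof (rule ccontr)
  assume "\<not> ?thesis"
  then have ds: "degree H s \<ge> \<tau> s + 2" by simp
  have val: "valid H \<tau>" using opt by (simp add: optimal_def)
  then have HF: "H \<subseteq> F" and tau: "\<And>v. v \<in> V \<Longrightarrow> \<tau> v \<le> degree H v"
    and tau_cases: "\<And>v. v \<in> V \<Longrightarrow> \<tau> v = lo v \<or> \<tau> v = hi v"
    by (auto simp: valid_def)
  have gH: "simple_graph V H" by (rule simple_graph_subset[OF graph HF])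
  have gN: "simple_graph V (F - H)" by (rule simple_graph_subset[OF graph]) auto
  define S where "S = (\<Union>n\<in>{n. odd n}. layer H s n)"
  define T where "T = (\<Union>n\<in>{n. even n}. layer H s n)"
  have SV: "S \<subseteq> V" and TV: "T \<subseteq> V" using layer_subset[OF s] by (auto simp: S_def T_def)
  have finS: "finite S" and finT: "finite T" using SV TV finite_V finite_subset by auto
  have dS: "degree H u = \<tau> u" if u: "u \<in> S" for u
  proof -
    obtain n where "odd n" "u \<in> layer H s n" using u unfolding S_def by blast
    then show ?thesis using no_augmenting_walk[OF opt s ds, of u n] by simp
  qed
  have dT: "degree H u \<ge> \<tau> u + 1" if u: "u \<in> T" for u
  proof -
    obtain n where "even n" "u \<in> layer H s n" using u unfolding T_def by blast
    then show ?thesis using no_augmenting_walk[OF opt s ds, of u n] by simp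
  qed
  have disj: "u \<notin> T" if "u \<in> S" for u using dS[OF that] dT[of u] by auto
  have sT: "s \<in> T" unfolding T_def by (rule UN_I[of 0]) auto
  have closT: "nbrs H w \<subseteq> S" if w: "w \<in> T" for w
  proof
    fix y assume y: "y \<in> nbrs H w"
    obtain n where n: "even n" "w \<in> layer H s n" using w by (auto simp: T_def)
    have "y \<in> layer H s (Suc n)" using n y HF by (auto simp: nbrs_def)
    then show "y \<in> S" unfolding S_def by (rule UN_I[rotated]) (use n in simp)
  qed
  have closS: "nbrs (F - H) u \<subseteq> T" if u: "u \<in> S" for u
  proof
    fix y assume y: "y \<in> nbrs (F - H) u"
    obtain n where n: "odd n" "u \<in> layer H s n" using u by (auto simp: S_def)
    have "y \<in> layer H s (Suc n)" using n y by (auto simp: nbrs_def)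
    then show "y \<in> T" unfolding T_def by (rule UN_I[rotated]) (use n in simp)
  qed

  \<comment> \<open>If some u in S sits at hi u and has many H-neighbours in T, dropping these edges moves u down
    to lo u and leaves room at the other ends, where the surplus of s can then be absorbed.\<close>
  have shift_down: "card (nbrs H u \<inter> T) < hi u - lo u" if u: "u \<in> S" and hi: "\<tau> u = hi u" for u
  proof (rule ccontr)
    assume "\<not> ?thesis"
    then obtain X where X: "X \<subseteq> nbrs H u \<inter> T" "card X = hi u - lo u"
      by (meson not_less obtain_subset_with_card_n)
    have uV: "u \<in> V" using u SV by auto
    let ?H = "H - star u X" and ?\<tau> = "\<tau>(u := lo u)"
    have uX: "u \<notin> X" using X disj[OF u] by auto
    have "X \<subseteq> nbrs H u" using X by auto
    note deg = degree_remove_star[OF gH this]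
    have deg': "degree ?H v = (if v = u then lo u else if v \<in> X then degree H v - 1 else degree H v)" for v
      using deg lo_hi[OF uV] dS[OF u] hi X(2) by auto
    have dX: "degree H x \<ge> \<tau> x + 1" if "x \<in> X" for x using X that dT by auto
    have val': "valid ?H ?\<tau>"
      using val dX by (force simp: valid_def deg')
    have le: "degree ?H v - (?\<tau> v + 1) \<le> degree H v - (\<tau> v + 1)" for v
      unfolding deg' by auto
    note tr = optimal_transfer[OF opt val' le]
    have dX': "degree H x = \<tau> x + 1" if "x \<in> X" for x
    proof -
      have "x \<in> V" "x \<noteq> u" using that X TV uX by auto
      then show ?thesis using tr(2)[of x] dX[OF that] that by (simp add: deg')
    qed
    then have sX: "s \<notin> X" "s \<noteq> u" using ds disj[OF u] sT by fastforce+
    have "\<exists>n. even n \<and> layer H s n \<inter> X \<noteq> {}"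
    proof -
      have "X \<noteq> {}" using X lo_hi[OF uV] by auto
      then obtain x where x: "x \<in> X" by auto
      then have "x \<in> T" using X by auto
      then obtain n where "even n" "x \<in> layer H s n" unfolding T_def by blast
      then show ?thesis using x by blast
    qed
    \<comment> \<open>Take the first even layer meeting \<open>X\<close>. Up to it no walk uses a
      deleted edge: an \<open>H\<close>-step leaves a vertex of \<open>T\<close>, which is not u and
      hence would have to lie in \<open>X\<close> already.\<close>
    then obtain n where n: "even n" "layer H s n \<inter> X \<noteq> {}"
      and least: "\<And>i. i < n \<Longrightarrow> even i \<Longrightarrow> layer H s i \<inter> X = {}"
      using exists_least_iff[of "\<lambda>n. even n \<and> layer H s n \<inter> X \<noteq> {}"] by blast
    obtain x where x: "x \<in> layer H s n" "x \<in> X" using n by auto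
    have "layer H s n \<subseteq> layer ?H s n"
    proof (rule layer_persists[where m = n])
      fix i y z assume i: "i < n" "y \<in> layer H s i" "{y, z} \<in> F" "{y, z} \<in> H \<longleftrightarrow> even i"
      have "\<not> (even i \<and> {y, z} \<in> star u X)"
      proof
        assume a: "even i \<and> {y, z} \<in> star u X"
        then have "y \<in> T" "y \<notin> X" using i least unfolding T_def by auto
        then show False using a disj[OF u] by (auto simp: mem_star)
      qed
      then show "{y, z} \<in> ?H \<longleftrightarrow> even i" using i by auto
    qed simp
    then have "x \<in> layer ?H s n" using x by auto
    moreover have "degree ?H s \<ge> ?\<tau> s + 2" using sX ds by (simp add: deg')
    ultimately have "degree ?H x \<ge> ?\<tau> x + 1"
      using no_augmenting_walk[OF tr(1) s, of x n] n by simp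
    then show False using x dX' uX by (auto simp: deg' split: if_splits)
  qed
  \<comment> \<open>The mirror image: adding edges from w to \<open>S\<close> lets w switch up to
    \<open>hi w\<close>, and the other ends get degree \<open>\<tau> + 1\<close>, which is forbidden
    in an odd layer.\<close>
  have shift_up: "card (nbrs (F - H) w \<inter> S) < hi w - lo w" if w: "w \<in> T" and lo: "\<tau> w = lo w" for w
  proof (rule ccontr)
    assume many: "\<not> ?thesis"
    have wV: "w \<in> V" using w TV by auto
    have "hi w + 1 - degree H w \<le> card (nbrs (F - H) w \<inter> S)"
      using many dT[OF w] lo by simp
    \<comment> \<open>Aiming at degree \<open>hi w + 1\<close> keeps \<open>X\<close> nonempty even
      if \<open>hi w = lo w + 1\<close>. Truncation makes \<open>X\<close> empty if w is already
      above that, a case that strictly lowers the surplus and is excluded below.\<close>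
    then obtain X where X: "X \<subseteq> nbrs (F - H) w \<inter> S" "card X = hi w + 1 - degree H w"
      by (meson obtain_subset_with_card_n)
    let ?H = "H \<union> star w X" and ?\<tau> = "\<tau>(w := hi w)"
    have wX: "w \<notin> X" using X disj w by auto
    have "X \<subseteq> nbrs (F - H) w" using X by auto
    note deg = degree_add_star[OF graph HF this]
    have deg': "degree ?H v = (if v = w then max (degree H w) (hi w + 1)
        else if v \<in> X then degree H v + 1 else degree H v)" for v
      using deg X(2) by auto
    have dX: "degree H x = \<tau> x" if "x \<in> X" for x using X that dS by auto
    have "star w X \<subseteq> F" using X by (auto simp: star_def nbrs_def)
    then have val': "valid ?H ?\<tau>"
      using val by (auto simp: valid_def deg' trans_le_add1 le_SucI)
    have le: "degree ?H v - (?\<tau> v + 1) \<le> degree H v - (\<tau> v + 1)" for v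
      using dX lo lo_hi[OF wV] by (auto simp: deg')
    note tr = optimal_transfer[OF opt val' le]
    have dw: "degree H w = \<tau> w + 1"
      using tr(2)[OF wV] dT[OF w] lo lo_hi[OF wV] by (auto simp: deg' max_def split: if_splits)
    then have sX: "s \<notin> X" "s \<noteq> w" using ds X disj sT by fastforce+
    have "\<exists>n. odd n \<and> layer H s n \<inter> X \<noteq> {}"
    proof -
      have "X \<noteq> {}" using X lo_hi[OF wV] dw lo by auto
      then obtain x where x: "x \<in> X" by auto
      then have "x \<in> S" using X by auto
      then obtain n where "odd n" "x \<in> layer H s n" unfolding S_def by blast
      then show ?thesis using x by blast
    qed
    then obtain n where n: "odd n" "layer H s n \<inter> X \<noteq> {}"
      and least: "\<And>i. i < n \<Longrightarrow> odd i \<Longrightarrow> layer H s i \<inter> X = {}"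
      using exists_least_iff[of "\<lambda>n. odd n \<and> layer H s n \<inter> X \<noteq> {}"] by blast
    obtain x where x: "x \<in> layer H s n" "x \<in> X" using n by auto
    have "layer H s n \<subseteq> layer ?H s n"
    proof (rule layer_persists[where m = n])
      fix i y z assume i: "i < n" "y \<in> layer H s i" "{y, z} \<in> F" "{y, z} \<in> H \<longleftrightarrow> even i"
      have "\<not> (odd i \<and> {y, z} \<in> star w X)"
      proof
        assume a: "odd i \<and> {y, z} \<in> star w X"
        then have "y \<in> S" "y \<notin> X" using i least unfolding S_def by auto
        then show False using a disj w by (auto simp: mem_star)
      qed
      then show "{y, z} \<in> ?H \<longleftrightarrow> even i" using i by auto
    qed simp
    then have "x \<in> layer ?H s n" using x by auto
    moreover have "degree ?H s \<ge> ?\<tau> s + 2" using sX ds by (simp add: deg')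
    ultimately have "degree ?H x = ?\<tau> x"
      using no_augmenting_walk[OF tr(1) s, of x n] n by simp
    then show False using x dX wX by (auto simp: deg' split: if_splits)
  qed

  have split: "card (nbrs (F - H) v) + degree H v = degree F v" for v
  proof -
    have "nbrs F v = nbrs (F - H) v \<union> nbrs H v" "nbrs (F - H) v \<inter> nbrs H v = {}"
      using HF by (auto simp: nbrs_def)
    then show ?thesis
      unfolding degree_eq_card_nbrs[OF graph] degree_eq_card_nbrs[OF gH]
      by (simp add: card_Un_disjoint finite_nbrs[OF gH] finite_nbrs[OF gN])
  qed
  \<comment> \<open>Double counting between \<open>S\<close> and \<open>T\<close>: all
    \<open>H\<close>-edges at \<open>T\<close> lead to \<open>S\<close>, all other edges at
    \<open>S\<close> lead to \<open>T\<close>.\<close>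
  define a where "a u = card (nbrs H u \<inter> T)" for u
  define b where "b w = card (nbrs (F - H) w \<inter> S)" for w
  have "(\<Sum>w\<in>T. degree H w) = (\<Sum>w\<in>T. card (nbrs H w \<inter> S))"
    using closT by (intro sum.cong) (auto simp: degree_eq_card_nbrs[OF gH] Int_absorb2)
  also have "\<dots> = (\<Sum>u\<in>S. a u)" unfolding a_def by (rule sum_card_nbrs_swap[OF finS finT])
  finally have 1: "(\<Sum>w\<in>T. degree H w) = (\<Sum>u\<in>S. a u)" .
  have "(\<Sum>u\<in>S. card (nbrs (F - H) u)) = (\<Sum>u\<in>S. card (nbrs (F - H) u \<inter> T))"
    using closS by (intro sum.cong) (auto simp: Int_absorb2)
  also have "\<dots> = (\<Sum>w\<in>T. b w)" unfolding b_def by (rule sum_card_nbrs_swap[OF finT finS])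
  finally have 2: "(\<Sum>u\<in>S. card (nbrs (F - H) u)) = (\<Sum>w\<in>T. b w)" .
  \<comment> \<open>At \<open>lo u\<close>, at most half of the edges at u are in \<open>H\<close>;
    at \<open>hi u\<close>, \<open>shift_down\<close> and \<open>gap_hi\<close> give
    \<open>a u < hi u - lo u \<le> degree F u - hi u\<close>.\<close>
  have Sle: "a u \<le> card (nbrs (F - H) u)" if u: "u \<in> S" for u
  proof -
    have uV: "u \<in> V" using u SV by auto
    have "a u \<le> degree H u"
      unfolding a_def degree_eq_card_nbrs[OF gH] by (intro card_mono finite_nbrs[OF gH]) auto
    then show ?thesis
      using tau_cases[OF uV] split[of u] dS[OF u] shift_down[OF u] lo_half[OF uV] gap_hi[OF uV] lo_hi[OF uV]
      unfolding a_def[symmetric] by auto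
  qed
  \<comment> \<open>At \<open>hi w\<close>, more than half of the edges at w are in \<open>H\<close>
    by \<open>hi_half\<close>; at \<open>lo w\<close>, \<open>shift_up\<close> and
    \<open>gap_lo\<close> give \<open>b w < hi w - lo w \<le> lo w\<close>.\<close>
  have Tless: "b w < degree H w" if w: "w \<in> T" for w
  proof -
    have wV: "w \<in> V" using w TV by auto
    have "b w \<le> card (nbrs (F - H) w)"
      unfolding b_def by (intro card_mono finite_nbrs[OF gN]) auto
    then show ?thesis
      using tau_cases[OF wV] split[of w] dT[OF w] shift_up[OF w] hi_half[OF wV] gap_lo[OF wV]
      unfolding b_def[symmetric] by auto
  qed
  have "(\<Sum>w\<in>T. b w) < (\<Sum>w\<in>T. degree H w)"
    using Tless sT by (intro sum_strict_mono finT) auto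
  moreover have "(\<Sum>u\<in>S. a u) \<le> (\<Sum>u\<in>S. card (nbrs (F - H) u))"
    using Sle by (rule sum_mono)
  ultimately show False using 1 2 by simp
qed

theorem degree_window_subgraph:
  "\<exists>H\<subseteq>F. \<forall>v\<in>V. degree H v \<in> {lo v, lo v + 1, hi v, hi v + 1}"
proof -
  have "hi v \<le> degree F v" if "v \<in> V" for v
    using gap_hi[OF that] lo_hi[OF that] by simp
  \<comment> \<open>The whole graph is a feasible start, so a pair of least surplus exists.\<close>
  then have "valid F hi" by (simp add: valid_def)
  then obtain p where p: "valid (fst p) (snd p)"
    "\<And>q. valid (fst q) (snd q) \<Longrightarrow> surplus (fst p) (snd p) \<le> surplus (fst q) (snd q)"
    using ex_has_least_nat[of "\<lambda>p. valid (fst p) (snd p)" "(F, hi)" "\<lambda>p. surplus (fst p) (snd p)"]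
    by auto
  obtain H \<tau> where H: "p = (H, \<tau>)" by fastforce
  then have opt: "optimal H \<tau>" using p(1) p(2)[of "(_, _)"] by (simp add: optimal_def)
  have "degree H v \<in> {lo v, lo v + 1, hi v, hi v + 1}" if v: "v \<in> V" for v
  proof -
    have "\<tau> v = lo v \<or> \<tau> v = hi v" "\<tau> v \<le> degree H v"
      using p(1) v H by (auto simp: valid_def)
    then show ?thesis using no_surplus[OF opt v] by auto
  qed
  then show ?thesis using p(1) H by (auto simp: valid_def)
qed

end

subsection \<open>Halving and prescribed residues\<close>

corollary halving_subgraph:
  assumes g: "simple_graph V F" and deg: "\<forall>v\<in>V. 3 \<le> degree F v"
  shows "\<exists>H\<subseteq>F. \<forall>v\<in>V. degree F v \<le> 2 * degree H v + 1 \<and> 2 * degree H v \<le> degree F v + 4"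
proof -
  \<comment> \<open>The binding condition is \<open>gap_hi\<close>: with d the degree, 2(d div 2 +
    1) \<le> d + d div 2 first holds at d = 3.\<close>
  interpret degree_windows V F "\<lambda>v. degree F v div 2" "\<lambda>v. degree F v div 2 + 1"
    using deg by unfold_locales (use g in force)+
  obtain H where "H \<subseteq> F" and H: "\<forall>v\<in>V. degree H v \<in>
      {degree F v div 2, degree F v div 2 + 1, degree F v div 2 + 1, degree F v div 2 + 1 + 1}"
    using degree_window_subgraph by blast
  have "degree F v \<le> 2 * degree H v + 1 \<and> 2 * degree H v \<le> degree F v + 4" if "v \<in> V" for v
  proof -
    have "degree H v \<in> {degree F v div 2, degree F v div 2 + 1, degree F v div 2 + 2}"
      using H that by force
    then show ?thesis by auto
  qed
  then show ?thesis using \<open>H \<subseteq> F\<close> by blast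
qed

text \<open>If \<open>degree F v + lo v\<close> is even, one more edge does not change the rounded
  half of the sum, and 2k more edges change it by k. So both windows, at distance
  \<open>2 * k v\<close>, give the same residue; \<open>8 * k v \<le> degree F v\<close> leaves room
  for them around half the degree.\<close>

corollary residue_subgraph:
  fixes k r :: "'a \<Rightarrow> nat"
  assumes g: "simple_graph V F"
    and k: "\<forall>v\<in>V. 8 * k v \<le> degree F v" and r: "\<forall>v\<in>V. r v < k v"
  shows "\<exists>H\<subseteq>F. \<forall>v\<in>V. (degree F v + degree H v) div 2 mod k v = r v"
proof -
  \<comment> \<open>The largest \<open>lo v \<le> degree F v div 2\<close> with \<open>degree F v + lo v\<close> congruent to \<open>2 * r v\<close>
    modulo \<open>2 * k v\<close>; adding \<open>2 * k v - 2 * r v\<close> instead of subtracting avoids truncation.\<close>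
  define A where "A v = degree F v + degree F v div 2 + (2 * k v - 2 * r v)" for v
  define lo where "lo v = degree F v div 2 - A v mod (2 * k v)" for v
  define hi where "hi v = lo v + 2 * k v" for v
  have less: "A v mod (2 * k v) < 2 * k v" if "v \<in> V" for v
    using r that by (metis mod_less_divisor gr_implies_not0 mult_pos_pos neq0_conv zero_less_numeral)
  have bounds: "lo v + A v mod (2 * k v) = degree F v div 2" "2 * k v \<le> lo v" "0 < k v"
    "8 * k v \<le> degree F v" if "v \<in> V" for v
  proof -
    show d: "8 * k v \<le> degree F v" using k that by auto
    show "0 < k v" using r that by fastforce
    show "lo v + A v mod (2 * k v) = degree F v div 2" "2 * k v \<le> lo v"
      using d less[OF that] unfolding lo_def by linarith+
  qed
  interpret degree_windows V F lo hi
  proof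
    show "simple_graph V F" by (rule g)
  qed (use bounds less in \<open>fastforce simp: hi_def\<close>)+
  obtain H where "H \<subseteq> F" and H: "\<forall>v\<in>V. degree H v \<in> {lo v, lo v + 1, hi v, hi v + 1}"
    using degree_window_subgraph by blast
  have "(degree F v + degree H v) div 2 mod k v = r v" if v: "v \<in> V" for v
  proof -
    have rv: "r v < k v" using r v by auto
    define q where "q = A v div (2 * k v)"
    have A: "A v = 2 * k v * q + A v mod (2 * k v)" by (simp add: q_def)
    have "2 * k v \<le> A v" using bounds[OF v] by (simp add: A_def)
    then have "0 < q" using bounds(3)[OF v] by (simp add: q_def div_greater_zero_iff)
    then obtain p where p: "q = Suc p" using gr0_implies_Suc by blast
    have "degree F v + lo v = 2 * (r v + k v * p)"
      using A bounds(1)[OF v] rv by (simp add: p A_def algebra_simps)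
    moreover have "degree H v \<in> {lo v, lo v + 1, lo v + 2 * k v, lo v + 2 * k v + 1}"
      using H v by (simp add: hi_def)
    ultimately have "(degree F v + degree H v) div 2 \<in> {r v + k v * p, r v + k v * Suc p}" by auto
    then show ?thesis using rv by (auto simp del: mult_Suc_right)
  qed
  then show ?thesis using \<open>H \<subseteq> F\<close> by blast
qed

section \<open>From residues of degrees to weightings\<close>

lemma weighted_degree_two_on:
  assumes "finite F" "H \<subseteq> F"
  shows "weighted_degree F (\<lambda>e. if e \<in> H then 2 else 1) v = degree F v + degree H v"
proof -
  have "weighted_degree F (\<lambda>e. if e \<in> H then 2 else 1) v
      = (\<Sum>e\<in>{e\<in>F. v \<in> e}. 1 + of_bool (e \<in> H))"
    unfolding weighted_degree_def by (intro sum.cong) auto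
  also have "\<dots> = degree F v + card ({e\<in>F. v \<in> e} \<inter> H)"
    using assms by (subst sum.distrib) (simp add: degree_def sum.If_cases of_bool_def)
  also have "{e\<in>F. v \<in> e} \<inter> H = {e\<in>H. v \<in> e}" using assms by auto
  finally show ?thesis by (simp add: degree_def)
qed

lemma degree_mono: "simple_graph V F \<Longrightarrow> H \<subseteq> F \<Longrightarrow> degree H v \<le> degree F v"
  unfolding degree_def by (intro card_mono) (auto dest: simple_graph_finite)

text \<open>Equal weighted degrees would have equal halves and so agree modulo every common divisor
  of the moduli. Very unequal degrees need no residues, as a weighted degree lies between the degree
  and its double.\<close>

lemma weight_colourable_12_by_residues:
  fixes k r :: "'a \<Rightarrow> nat"
  assumes g: "simple_graph V F"
    and k: "\<forall>v\<in>V. 8 * k v \<le> degree F v" and r: "\<forall>v\<in>V. r v < k v"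
    and sep: "\<And>u v. {u, v} \<in> F \<Longrightarrow> (\<exists>m. m dvd k u \<and> m dvd k v \<and> r u mod m \<noteq> r v mod m)
        \<or> 2 * degree F u < degree F v \<or> 2 * degree F v < degree F u"
  shows "weight_colourable_12 V F"
proof -
  obtain H where HF: "H \<subseteq> F" and H: "\<forall>v\<in>V. (degree F v + degree H v) div 2 mod k v = r v"
    using residue_subgraph[OF g k r] by blast
  let ?c = "\<lambda>e. if e \<in> H then 2 else 1 :: nat"
  have wd: "weighted_degree F ?c v = degree F v + degree H v" for v
    by (rule weighted_degree_two_on[OF simple_graph_finite[OF g] HF])
  have "weighted_degree F ?c u \<noteq> weighted_degree F ?c v" if uv: "{u, v} \<in> F" for u v
  proof
    assume eq: "weighted_degree F ?c u = weighted_degree F ?c v"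
    have V: "u \<in> V" "v \<in> V" using uv g by (auto simp: simple_graph_def)
    have "degree H u \<le> degree F u" "degree H v \<le> degree F v" by (rule degree_mono[OF g HF])+
    then have "\<not> 2 * degree F u < degree F v" "\<not> 2 * degree F v < degree F u"
      using eq unfolding wd by linarith+
    then obtain m where m: "m dvd k u" "m dvd k v" "r u mod m \<noteq> r v mod m"
      using sep[OF uv] by blast
    have "r u mod m = (degree F u + degree H u) div 2 mod m"
      "r v mod m = (degree F v + degree H v) div 2 mod m"
      using H V m by (metis mod_mod_cancel)+
    then show False using m(3) eq unfolding wd by simp
  qed
  then show ?thesis unfolding weight_colourable_12_def by (intro exI[of _ ?c]) auto
qed

subsection \<open>Labels with few conflicts\<close>

text \<open>For powers of two, the case applied later, the minimum is the gcd of the moduli, the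
  finest modulus at which both labels can be compared.\<close>

definition conflict :: "('a \<Rightarrow> nat) \<Rightarrow> ('a \<Rightarrow> nat) \<Rightarrow> 'a \<Rightarrow> 'a \<Rightarrow> bool" where
  "conflict k f u v \<longleftrightarrow> f u mod min (k u) (k v) = f v mod min (k u) (k v)"

lemma conflict_sym: "conflict k f u v \<longleftrightarrow> conflict k f v u"
  by (auto simp: conflict_def min.commute)

lemma card_residue_class_le: "card {a. a < m * q \<and> a mod m = (s :: nat)} \<le> q"
proof -
  have "card {a. a < m * q \<and> a mod m = s} \<le> card {..<q}"
  proof (rule card_inj_on_le)
    show "inj_on (\<lambda>a. a div m) {a. a < m * q \<and> a mod m = s}"
    proof (rule inj_onI)
      fix a b assume ab: "a \<in> {a. a < m * q \<and> a mod m = s}" "b \<in> {a. a < m * q \<and> a mod m = s}"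
        "a div m = b div m"
      then show "a = b" by (metis (mono_tags, lifting) div_mult_mod_eq mem_Collect_eq)
    qed
    show "(\<lambda>a. a div m) ` {a. a < m * q \<and> a mod m = s} \<subseteq> {..<q}"
      by (auto simp: less_mult_imp_div_less mult.commute)
  qed simp
  then show ?thesis by simp
qed

text \<open>Isolates the terms that change when only v is relabelled.\<close>

lemma sum_nbrs_split_vertex:
  fixes f :: "'a \<Rightarrow> 'a \<Rightarrow> nat"
  assumes g: "simple_graph V N" and v: "v \<in> V"
  shows "(\<Sum>x\<in>V. \<Sum>u\<in>nbrs N x. f x u) = (\<Sum>u\<in>nbrs N v. f v u) + (\<Sum>u\<in>nbrs N v. f u v)
    + (\<Sum>x\<in>V - {v}. \<Sum>u\<in>nbrs N x - {v}. f x u)"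
proof -
  have fV: "finite V" using g by (simp add: simple_graph_def)
  note fin = finite_nbrs[OF g]
  have "(\<Sum>u\<in>nbrs N x. f x u) = (if x \<in> nbrs N v then f x v else 0) + (\<Sum>u\<in>nbrs N x - {v}. f x u)" for x
    using fin by (cases "v \<in> nbrs N x") (auto simp: sum.remove nbrs_sym[of x])
  then have "(\<Sum>x\<in>V - {v}. \<Sum>u\<in>nbrs N x. f x u)
      = (\<Sum>x\<in>V - {v}. if x \<in> nbrs N v then f x v else 0) + (\<Sum>x\<in>V - {v}. \<Sum>u\<in>nbrs N x - {v}. f x u)"
    by (simp add: sum.distrib)
  moreover have "(\<Sum>x\<in>V - {v}. if x \<in> nbrs N v then f x v else 0) = (\<Sum>u\<in>nbrs N v. f u v)"
  proof -
    have "(V - {v}) \<inter> nbrs N v = nbrs N v" using nbrs_subset[OF g] not_nbrs_self[OF g] by fast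
    then show ?thesis using fV by (simp add: sum.inter_restrict[symmetric])
  qed
  ultimately show ?thesis using fV v by (simp add: sum.remove)
qed

lemma exists_labels:
  fixes k :: "'a \<Rightarrow> nat"
  assumes g: "simple_graph V N"
    and deg: "\<forall>v\<in>V. degree N v \<le> 64 * k v"
    and big: "\<forall>v\<in>V. 15625 \<le> k v"
    and dv: "\<And>u v. {u, v} \<in> N \<Longrightarrow> min (k u) (k v) dvd k v \<and> k v \<le> 8 * min (k u) (k v)"
  shows "\<exists>r c :: 'a \<Rightarrow> nat. (\<forall>v\<in>V. r v < k v \<and> c v < k v)
    \<and> (\<forall>u v. {u, v} \<in> N \<longrightarrow> \<not> (conflict k r u v \<and> conflict k c u v))
    \<and> (\<forall>v\<in>V. card {u\<in>nbrs N v. conflict k r v u} + card {u\<in>nbrs N v. conflict k c v u} \<le> 1548)"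
proof -
  \<comment> \<open>A random choice of the labels of one vertex costs at most \<open>1548\<close> on average, so any
    larger penalty on double conflicts rules them out in a minimal assignment.\<close>
  define cost :: "('a \<Rightarrow> nat) \<Rightarrow> ('a \<Rightarrow> nat) \<Rightarrow> 'a \<Rightarrow> 'a \<Rightarrow> nat" where
    "cost r c u v = of_bool (conflict k r u v) + of_bool (conflict k c u v)
       + 2000 * (of_bool (conflict k r u v) * of_bool (conflict k c u v))" for r c u v
  have cost_sym: "cost r c u v = cost r c v u" for r c u v
    unfolding cost_def by (simp add: conflict_sym[of k _ u])
  define total where "total p = (\<Sum>x\<in>V. \<Sum>u\<in>nbrs N x. cost (fst p) (snd p) x u)" for p
  define ok where "ok p \<longleftrightarrow> (\<forall>v\<in>V. fst p v < k v \<and> snd p v < k v)" for p :: "('a \<Rightarrow> nat) \<times> ('a \<Rightarrow> nat)"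
  have "ok (\<lambda>_. 0, \<lambda>_. 0)" using big by (fastforce simp: ok_def)
  then obtain p where "ok p" and p: "\<And>q. ok q \<Longrightarrow> total p \<le> total q"
    using ex_has_least_nat[of ok _ total] by blast
  obtain r c where rc: "p = (r, c)" by fastforce
  have ok: "\<forall>v\<in>V. r v < k v \<and> c v < k v" using \<open>ok p\<close> rc by (simp add: ok_def)
  have small: "(\<Sum>u\<in>nbrs N v. cost r c v u) \<le> 1548" (is "?f \<le> _") if v: "v \<in> V" for v
  proof -
    let ?g = "\<lambda>a b u. cost (r(v := a)) (c(v := b)) v u"
    have local_min: "?f \<le> (\<Sum>u\<in>nbrs N v. ?g a b u)" if ab: "a < k v" "b < k v" for a b
    proof -
      let ?q = "(r(v := a), c(v := b))"
      have "ok ?q" using ok ab by (simp add: ok_def)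
      then have le: "total p \<le> total ?q" by (rule p)
      have tot: "total (r', c') = 2 * (\<Sum>u\<in>nbrs N v. cost r' c' v u)
          + (\<Sum>x\<in>V - {v}. \<Sum>u\<in>nbrs N x - {v}. cost r' c' x u)" for r' c'
        unfolding total_def using sum_nbrs_split_vertex[OF g v, of "cost r' c'"]
        by (simp add: cost_sym[of _ _ _ v])
      have "(\<Sum>x\<in>V - {v}. \<Sum>u\<in>nbrs N x - {v}. cost (r(v := a)) (c(v := b)) x u)
          = (\<Sum>x\<in>V - {v}. \<Sum>u\<in>nbrs N x - {v}. cost r c x u)"
        by (intro sum.cong refl) (simp add: cost_def conflict_def)
      then show ?thesis using le tot rc by simp
    qed
    \<comment> \<open>A residue class modulo m contains at most 8 labels below \<open>k v\<close>,
      since \<open>k v \<le> 8 * m\<close>. Over all pairs (a, b) this costs at most 8k for each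
      kind of conflict and 2000 * 8 * 8 for double ones.\<close>
    have each: "(\<Sum>a<k v. \<Sum>b<k v. ?g a b u) \<le> 16 * k v + 128000" if u: "u \<in> nbrs N v" for u
    proof -
      define m where "m = min (k v) (k u)"
      have uv: "{u, v} \<in> N" using u by (simp add: nbrs_def insert_commute)
      have m: "m dvd k v" "k v \<le> 8 * m" using dv[OF uv] by (simp_all add: m_def min.commute)
      then obtain q where q: "k v = m * q" by (elim dvdE)
      have "k v > 0" using big v by fastforce
      moreover have "m * q \<le> 8 * m" using m(2) q by simp
      ultimately have q8: "q \<le> 8" using q by (simp add: mult.commute[of m])
      have ne: "u \<noteq> v" using u not_nbrs_self[OF g] by blast
      define P where "P f = (\<Sum>a<k v. of_bool (a mod m = f mod m) :: nat)" for f :: nat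
      have P8: "P f \<le> 8" for f
      proof -
        have "P f = card ({..<k v} \<inter> {a. a mod m = f mod m})"
          unfolding P_def by (simp add: sum.If_cases of_bool_def)
        also have "{..<k v} \<inter> {a. a mod m = f mod m} = {a. a < m * q \<and> a mod m = f mod m}"
          using q by auto
        also have "card \<dots> \<le> q" by (rule card_residue_class_le)
        finally show ?thesis using q8 by simp
      qed
      have expand: "(\<Sum>a<n. \<Sum>b<n. p a + q b + 2000 * (p a * q b))
          = n * (\<Sum>a<n. p a) + n * (\<Sum>b<n. q b) + 2000 * ((\<Sum>a<n. p a) * (\<Sum>b<n. q b))"
        for n and p q :: "nat \<Rightarrow> nat"
        by (simp add: sum.distrib sum_distrib_left[symmetric] sum_distrib_right[symmetric])
      have "?g a b u = of_bool (a mod m = r u mod m) + of_bool (b mod m = c u mod m)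
          + 2000 * (of_bool (a mod m = r u mod m) * of_bool (b mod m = c u mod m))" for a b
        using ne by (simp add: cost_def conflict_def m_def)
      then have "(\<Sum>a<k v. \<Sum>b<k v. ?g a b u)
          = k v * P (r u) + k v * P (c u) + 2000 * (P (r u) * P (c u))"
        unfolding P_def by (simp only: expand)
      also have "\<dots> \<le> k v * 8 + k v * 8 + 2000 * (8 * 8)"
        by (intro add_mono mult_le_mono order_refl P8)
      finally show ?thesis by simp
    qed
    have "k v * (k v * ?f) = (\<Sum>a<k v. \<Sum>b<k v. ?f)" by simp
    also have "\<dots> \<le> (\<Sum>a<k v. \<Sum>b<k v. \<Sum>u\<in>nbrs N v. ?g a b u)"
      by (intro sum_mono local_min) auto
    also have "\<dots> = (\<Sum>u\<in>nbrs N v. \<Sum>a<k v. \<Sum>b<k v. ?g a b u)"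
      by (simp add: sum.swap[of _ _ "nbrs N v"])
    also have "\<dots> \<le> (\<Sum>u\<in>nbrs N v. 16 * k v + 128000)" by (intro sum_mono each)
    also have "\<dots> = degree N v * (16 * k v + 128000)" by (simp add: degree_eq_card_nbrs[OF g])
    also have "\<dots> \<le> 64 * k v * (16 * k v + 128000)" using deg v by (intro mult_le_mono) auto
    also have "\<dots> = k v * (1024 * k v + 8192000)" by (simp add: algebra_simps)
    \<comment> \<open>The average cost is thus at most 1024 + 8192000 / k \<le> 1548.288, as k is at
      least 15625 = 10^6 / 64; an integer below it is at most 1548.\<close>
    finally have "k v * ?f \<le> 1024 * k v + 8192000" using big v by fastforce
    moreover have "15625 \<le> k v" using big v by blast
    moreover have "k v * 1549 \<le> k v * ?f" if "\<not> ?f \<le> 1548" using that by (intro mult_le_mono) auto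
    ultimately show ?thesis by linarith
  qed
  have "\<not> (conflict k r u v \<and> conflict k c u v)" if uv: "{u, v} \<in> N" for u v
  proof
    assume a: "conflict k r u v \<and> conflict k c u v"
    have "u \<in> V" "v \<in> nbrs N u" using uv g by (auto simp: simple_graph_def nbrs_def)
    then have "cost r c u v \<le> 1548"
      using small[of u] member_le_sum[of v "nbrs N u" "cost r c u"] finite_nbrs[OF g] by fastforce
    then show False using a by (simp add: cost_def)
  qed
  moreover have "card {u\<in>nbrs N v. conflict k r v u} + card {u\<in>nbrs N v. conflict k c v u} \<le> 1548"
    if v: "v \<in> V" for v
  proof -
    have c: "card {u\<in>nbrs N v. P u} = (\<Sum>u\<in>nbrs N v. of_bool (P u))" for P
      using finite_nbrs[OF g, of v] by (simp add: sum.If_cases of_bool_def Int_def)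
    have "card {u\<in>nbrs N v. conflict k r v u} + card {u\<in>nbrs N v. conflict k c v u}
        \<le> (\<Sum>u\<in>nbrs N v. cost r c v u)"
      unfolding c sum.distrib[symmetric] cost_def by (intro sum_mono) simp
    then show ?thesis using small[OF v] by simp
  qed
  ultimately show ?thesis using ok by blast
qed

section \<open>Assembling the decomposition\<close>

lemma degree_union_disjoint:
  assumes "finite A" "finite B" "A \<inter> B = {}"
  shows "degree (A \<union> B) v = degree A v + degree B v"
proof -
  have "{e \<in> A \<union> B. v \<in> e} = {e\<in>A. v \<in> e} \<union> {e\<in>B. v \<in> e}" by auto
  then show ?thesis unfolding degree_def using assms by (simp add: card_Un_disjoint disjoint_iff)
qed

theorem theorem6:
  fixes V :: "'a set" and E :: "'a set set"
  assumes "simple_graph V E"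
    and "\<forall>v\<in>V. degree E v \<ge> 10^6"
  shows "\<exists>E1 E2. E1 \<union> E2 = E \<and> E1 \<inter> E2 = {} \<and>
           weight_colourable_12 V E1 \<and> weight_colourable_12 V E2"
proof -
  note g = assms(1)
  let ?d = "degree E"
  have d: "1000000 \<le> ?d v" if "v \<in> V" for v using assms(2) that by simp
  have "\<exists>j. 32 * 2 ^ j \<le> ?d v \<and> ?d v < 64 * 2 ^ j" if v: "v \<in> V" for v
  proof -
    have "1 \<le> ?d v div 32" using d[OF v] by linarith
    then obtain j where "2 ^ j \<le> ?d v div 32" "?d v div 32 < 2 ^ (j + 1)"
      using ex_power_ivl1[of 2 "?d v div 32"] by auto
    then show ?thesis by (intro exI[of _ j]) (simp add: field_simps, linarith)
  qed
  then obtain j where j: "\<And>v. v \<in> V \<Longrightarrow> 32 * 2 ^ j v \<le> ?d v \<and> ?d v < 64 * 2 ^ j v" by metis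
  define k :: "'a \<Rightarrow> nat" where "k v = 2 ^ j v" for v
  have k: "32 * k v \<le> ?d v" "?d v < 64 * k v" if "v \<in> V" for v
    using j[OF that] by (auto simp: k_def)
  have min_dvd: "min (k u) (k v) dvd k v" "min (k u) (k v) dvd k u" for u v
    by (auto simp: k_def min_def le_imp_power_dvd dest: power_le_imp_le_exp[rotated])

  \<comment> \<open>Labels only matter on edges whose ends have comparable degrees: both parts will take about half
    of each degree, so at the other edges one weighted degree is larger whatever the weights are.\<close>
  define N where "N = {e\<in>E. \<forall>u\<in>e. \<forall>v\<in>e. ?d u \<le> 4 * ?d v}"
  have gN: "simple_graph V N" by (rule simple_graph_subset[OF g]) (auto simp: N_def)
  have mem_V: "u \<in> V \<and> v \<in> V" if "{u, v} \<in> E" for u v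
    using that g by (auto simp: simple_graph_def)
  have "\<exists>r c :: 'a \<Rightarrow> nat. (\<forall>v\<in>V. r v < k v \<and> c v < k v)
    \<and> (\<forall>u v. {u, v} \<in> N \<longrightarrow> \<not> (conflict k r u v \<and> conflict k c u v))
    \<and> (\<forall>v\<in>V. card {u\<in>nbrs N v. conflict k r v u} + card {u\<in>nbrs N v. conflict k c v u} \<le> 1548)"
  proof (rule exists_labels[OF gN])
    show "\<forall>v\<in>V. degree N v \<le> 64 * k v"
    proof
      fix v assume "v \<in> V"
      moreover have "degree N v \<le> ?d v" by (rule degree_mono[OF g]) (auto simp: N_def)
      ultimately show "degree N v \<le> 64 * k v" using k by fastforce
    qed
    show "\<forall>v\<in>V. 15625 \<le> k v" using k d by fastforce
    fix u v assume uv: "{u, v} \<in> N"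
    then have V: "u \<in> V" "v \<in> V" using mem_V by (auto simp: N_def)
    have "?d v \<le> 4 * ?d u" using uv by (auto simp: N_def)
    \<comment> \<open>From \<open>32 * k v \<le> ?d v \<le> 4 * ?d u < 256 * k u\<close>, the moduli
      differ by a factor below 8.\<close>
    then show "min (k u) (k v) dvd k v \<and> k v \<le> 8 * min (k u) (k v)"
      using k[OF V(1)] k[OF V(2)] min_dvd by (auto simp: min_def)
  qed
  then obtain r c where r: "\<forall>v\<in>V. r v < k v" and c: "\<forall>v\<in>V. c v < k v"
    and both: "\<And>u v. {u, v} \<in> N \<Longrightarrow> \<not> (conflict k r u v \<and> conflict k c u v)"
    and few: "\<And>v. v \<in> V \<Longrightarrow> card {u\<in>nbrs N v. conflict k r v u} + card {u\<in>nbrs N v. conflict k c v u} \<le> 1548"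
    by blast
  define conf where "conf f = {e\<in>N. \<forall>u\<in>e. \<forall>v\<in>e. conflict k f u v}" for f
  have mem_conf: "{u, v} \<in> conf f \<longleftrightarrow> {u, v} \<in> N \<and> conflict k f u v" for f u v
    by (auto simp: conf_def conflict_sym[of k f u v]) (auto simp: conflict_def)
  have confN: "conf f \<subseteq> N" for f by (auto simp: conf_def)
  have NE: "N \<subseteq> E" by (auto simp: N_def)
  have deg_conf: "degree (conf f) v = card {u\<in>nbrs N v. conflict k f v u}" for f v
  proof -
    have "nbrs (conf f) v = {u\<in>nbrs N v. conflict k f v u}" by (auto simp: nbrs_def mem_conf)
    then show ?thesis using degree_eq_card_nbrs[OF simple_graph_subset[OF gN confN]] by simp
  qed
  let ?R = "conf r" and ?C = "conf c"
  have RC: "?R \<inter> ?C = {}"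
  proof (rule ccontr)
    assume "?R \<inter> ?C \<noteq> {}"
    then obtain e where e: "e \<in> ?R" "e \<in> ?C" by auto
    then have "card e = 2" using gN confN by (auto simp: simple_graph_def)
    then obtain u v where "e = {u, v}" by (meson card_2_iff)
    then show False using e both by (auto simp: mem_conf)
  qed
  define F where "F = E - (?R \<union> ?C)"
  have gF: "simple_graph V F" by (rule simple_graph_subset[OF g]) (auto simp: F_def)
  have fin: "finite E" "finite F" "finite ?R" "finite ?C"
    using simple_graph_finite g gF gN simple_graph_subset confN by metis+
  have dF: "?d v = degree F v + (degree ?R v + degree ?C v)" for v
  proof -
    have "E = F \<union> (?R \<union> ?C)" using confN NE by (auto simp: F_def)
    then have "?d v = degree (F \<union> (?R \<union> ?C)) v" by simp
    also have "\<dots> = degree F v + degree (?R \<union> ?C) v"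
      by (intro degree_union_disjoint) (use fin in \<open>auto simp: F_def\<close>)
    also have "degree (?R \<union> ?C) v = degree ?R v + degree ?C v"
      by (intro degree_union_disjoint fin RC)
    finally show ?thesis .
  qed
  have few': "degree ?R v + degree ?C v \<le> 1548" if "v \<in> V" for v
    using few[OF that] by (simp add: deg_conf)
  have "\<forall>v\<in>V. 3 \<le> degree F v"
  proof
    fix v assume v: "v \<in> V"
    show "3 \<le> degree F v" using d[OF v] dF[of v] few'[OF v] by linarith
  qed
  then obtain H where HF: "H \<subseteq> F"
    and H: "\<And>v. v \<in> V \<Longrightarrow> degree F v \<le> 2 * degree H v + 1 \<and> 2 * degree H v \<le> degree F v + 4"
    using halving_subgraph[OF gF] by blast
  have fH: "finite H" "finite (F - H)" using fin HF finite_subset by auto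
  have dFH: "degree F v = degree (F - H) v + degree H v" for v
    using degree_union_disjoint[of "F - H" H v] fH HF by (simp add: Un_absorb2 Int_commute)
  \<comment> \<open>Used once with the labels r and once with c. The error 1552 is 1548 for the
    conflict edges plus 4 for the halving.\<close>
  have colourable: "weight_colourable_12 V G"
    if GE: "G \<subseteq> E" and f: "\<forall>v\<in>V. f v < k v" and disj: "G \<inter> conf f = {}"
      and dG: "\<And>v. v \<in> V \<Longrightarrow> ?d v \<le> 2 * degree G v + 1552 \<and> 2 * degree G v \<le> ?d v + 1552" for G f
  proof (rule weight_colourable_12_by_residues[OF simple_graph_subset[OF g GE] _ f])
    show "\<forall>v\<in>V. 8 * k v \<le> degree G v"
    proof
      fix v assume v: "v \<in> V"
      \<comment> \<open>Half of \<open>?d v\<close> is at least \<open>16 * k v\<close>; the slack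
        absorbs the error.\<close>
      show "8 * k v \<le> degree G v" using dG[OF v] k[OF v] d[OF v] by linarith
    qed
    fix u v assume uv: "{u, v} \<in> G"
    then have E: "{u, v} \<in> E" using GE by auto
    then have V: "u \<in> V" "v \<in> V" using mem_V by auto
    show "(\<exists>m. m dvd k u \<and> m dvd k v \<and> f u mod m \<noteq> f v mod m)
        \<or> 2 * degree G u < degree G v \<or> 2 * degree G v < degree G u"
    proof (cases "{u, v} \<in> N")
      case True
      then have "\<not> conflict k f u v" using uv disj mem_conf by blast
      then show ?thesis using min_dvd unfolding conflict_def by blast
    next
      case False
      \<comment> \<open>A ratio above 4 in \<open>E\<close> stays above 2 after halving, as the
        error is tiny against 10^6.\<close>
      then have "4 * ?d v < ?d u \<or> 4 * ?d u < ?d v" using E by (auto simp: N_def)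
      then show ?thesis using dG[OF V(1)] dG[OF V(2)] d[OF V(1)] d[OF V(2)] by linarith
    qed
  qed
  \<comment> \<open>By \<open>RC\<close>, edges with a c-conflict have no r-conflict, so they are
    safe in the part governed by r.\<close>
  have "weight_colourable_12 V (H \<union> ?C)"
  proof (rule colourable[OF _ r])
    fix v assume v: "v \<in> V"
    have "degree (H \<union> ?C) v = degree H v + degree ?C v"
      by (rule degree_union_disjoint) (use fin fH HF in \<open>auto simp: F_def\<close>)
    then show "?d v \<le> 2 * degree (H \<union> ?C) v + 1552 \<and> 2 * degree (H \<union> ?C) v \<le> ?d v + 1552"
      using H[OF v] dF[of v] few'[OF v] by linarith
  qed (use HF confN NE RC in \<open>auto simp: F_def\<close>)
  moreover have "weight_colourable_12 V (F - H \<union> ?R)"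
  proof (rule colourable[OF _ c])
    fix v assume v: "v \<in> V"
    have "degree (F - H \<union> ?R) v = degree (F - H) v + degree ?R v"
      by (rule degree_union_disjoint) (use fin fH in \<open>auto simp: F_def\<close>)
    then show "?d v \<le> 2 * degree (F - H \<union> ?R) v + 1552 \<and> 2 * degree (F - H \<union> ?R) v \<le> ?d v + 1552"
      using H[OF v] dF[of v] few'[OF v] dFH[of v] by linarith
  qed (use confN NE RC in \<open>auto simp: F_def\<close>)
  moreover have "(H \<union> ?C) \<union> (F - H \<union> ?R) = E" "(H \<union> ?C) \<inter> (F - H \<union> ?R) = {}"
    using HF confN NE RC by (auto simp: F_def)
  ultimately show ?thesis by blast
qed

end
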